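(* Consider the two-stage electricity market with a day-ahead market power mitigation (MPM) policy and price-taking participants described in the context, with generators $\mathcal{G}$ (cost coefficients $c_j>0$, estimation errors $\epsilon_j\ge 0$), loads $\mathcal{L}$ (inelastic demands $d_l$), and aggregate demand $d=\sum_{l}d_l>0$. A competitive equilibrium exists and is given by: $$g_j^{d}=\frac{(c_j+\epsilon_j)^{-1}}{\sum_{k\in\mathcal{G}}c_k^{-1}}\,d,\qquad g_j^{r}=\frac{\epsilon_j c_j^{-1}}{c_j+\epsilon_j}\,\frac{d}{\sum_{k\in\mathcal{G}}c_k^{-1}},\qquad\forall j\in\mathcal{G},$$ $$d_l^{d}+d_l^{r}=d_l\ \ \forall l\in\mathcal{L},\qquad d^{d}=\frac{\sum_{j\in\mathcal{G}}(c_j+\epsilon_j)^{-1}}{\sum_{j\in\mathcal{G}}c_j^{-1}}\,d,\qquad d^{r}=d-d^{d},$$ $$\theta_j^{r}=\frac{\epsilon_j c_j^{-1}}{c_j+\epsilon_j}\ \ \forall j\in\mathcal{G},\qquad \lambda^{d}=\lambda^{r}=\frac{d}{\sum_{j\in\mathcal{G}}c_j^{-1}},$$ where $d^d=\sum_{l\in\mathcal{L}}d_l^d$ and $d^r=\sum_{l\in\mathcal{L}}d_l^r$ (the individual day-ahead allocations $d_l^d$ being otherwise arbitrary).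
   Context: Setting. $\mathcal{G}$ is a finite nonempty set of generators and $\mathcal{L}$ a finite nonempty set of loads. Generator $j$ has cost $\frac{c_j}{2}g_j^2$, $c_j>0$, for total output $g_j=g_j^d+g_j^r\in\mathbb{R}$ (superscripts $d$, $r$: day-ahead, real-time). Load $l$ has fixed demand $d_l\in\mathbb{R}$, split as $d_l=d_l^d+d_l^r$ with $d_l^d\in\mathbb{R}$ chosen by the load. Put $d=\sum_l d_l>0$, $d^d=\sum_l d_l^d$, $d^r=\sum_l d_l^r$. Prices are $\lambda^d,\lambda^r\in\mathbb{R}$. Day-ahead stage with MPM policy. Generators do not bid. The operator estimates the cost coefficient of generator $j$ as $c_j+\epsilon_j$, $\epsilon_j\ge0$, and dispatches $g_j^d=(c_j+\epsilon_j)^{-1}\lambda^d$; the balance $\sum_j g_j^d=d^d$ gives $\lambda^d=d^d/\sum_{j}(c_j+\epsilon_j)^{-1}$. Real-time stage. Generator $j$ bids a slope $\theta_j^r\in\mathbb{R}$ and is dispatched $g_j^r=\theta_j^r\lambda^r$. The market clears when $\sum_j\theta_j^r\lambda^r=d^r$. Degenerate case: if $\sum_j\theta_j^r\lambda^r=0$ and $d^r=0$, the price $\lambda^r$ is set equal to $\lambda^d$. Price-taking participants. With $\omega_j:=\frac{(c_j+\epsilon_j)^{-1}}{\sum_k(c_k+\epsilon_k)^{-1}}$ (so that $g_j^d=\omega_j d^d$), generator $j$, taking $\lambda^r$ and its day-ahead dispatch as given, chooses $\theta_j^r\in\mathbb{R}$ to maximize $$\pi_j=(c_j+\epsilon_j)(\omega_j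 d^d)^2+\theta_j^r(\lambda^r)^2-\tfrac{c_j}{2}\left(\omega_j d^d+\theta_j^r\lambda^r\right)^2 .$$ Load $l$, taking $\lambda^d,\lambda^r$ as given, chooses $d_l^d\in\mathbb{R}$ to minimize $\rho_l=\lambda^d d_l^d+\lambda^r(d_l-d_l^d)$. A competitive equilibrium is a collection of bids $(\theta_j^r)_j$, allocations $(d_l^d,d_l^r)_l$ and prices $(\lambda^d,\lambda^r)$ such that every generator's bid maximizes its profit given prices, every load's allocation minimizes its payment given prices, and supply equals demand in both stages, where $\lambda^d=d^d/\sum_{j}(c_j+\epsilon_j)^{-1}$ and $\lambda^r$ satisfies the real-time clearing condition $\sum_j\theta_j^r\lambda^r=d^r$ (with $\lambda^r=\lambda^d$ in the degenerate case $\sum_j\theta_j^r\lambda^r=0$, $d^r=0$). *)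

theory Defs
  imports Complex_Main
begin

text \<open>
  Naming: \<open>G\<close>, \<open>L\<close> are the generators and loads; \<open>c\<close>, \<open>eps\<close> the cost coefficients and their
  estimation errors; \<open>dem l\<close> the fixed demand of load \<open>l\<close>; \<open>theta\<close> the real-time bids;
  \<open>dd\<close>, \<open>dr\<close> the day-ahead and real-time allocations of the loads; \<open>lamd\<close>, \<open>lamr\<close> the
  day-ahead and real-time prices.
\<close>

definition da_dispatch :: "('g \<Rightarrow> real) \<Rightarrow> ('g \<Rightarrow> real) \<Rightarrow> real \<Rightarrow> 'g \<Rightarrow> real" where
  "da_dispatch c eps lamd j = inverse (c j + eps j) * lamd"

definition da_price :: "'g set \<Rightarrow> ('g \<Rightarrow> real) \<Rightarrow> ('g \<Rightarrow> real) \<Rightarrow> real \<Rightarrow> real" where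
  "da_price G c eps Dd = Dd / (\<Sum>j\<in>G. inverse (c j + eps j))"

definition rt_dispatch :: "('g \<Rightarrow> real) \<Rightarrow> real \<Rightarrow> 'g \<Rightarrow> real" where
  "rt_dispatch theta lamr j = theta j * lamr"

definition da_share :: "'g set \<Rightarrow> ('g \<Rightarrow> real) \<Rightarrow> ('g \<Rightarrow> real) \<Rightarrow> 'g \<Rightarrow> real" where
  "da_share G c eps j = inverse (c j + eps j) / (\<Sum>k\<in>G. inverse (c k + eps k))"

text \<open>
  Profit of generator \<open>j\<close> as a function of its own bid \<open>t\<close>. The day-ahead dispatch
  \<open>da_share G c eps j * Dd\<close> and the price \<open>lamr\<close> do not depend on \<open>t\<close> (price taking); the first
  summand is the day-ahead revenue, since the day-ahead price is \<open>c j + eps j\<close> times the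
  day-ahead dispatch.
\<close>

definition gen_profit ::
  "'g set \<Rightarrow> ('g \<Rightarrow> real) \<Rightarrow> ('g \<Rightarrow> real) \<Rightarrow> real \<Rightarrow> real \<Rightarrow> 'g \<Rightarrow> real \<Rightarrow> real" where
  "gen_profit G c eps Dd lamr j t =
     (c j + eps j) * (da_share G c eps j * Dd)\<^sup>2 + t * lamr\<^sup>2
       - c j / 2 * (da_share G c eps j * Dd + t * lamr)\<^sup>2"

definition load_payment :: "real \<Rightarrow> real \<Rightarrow> real \<Rightarrow> real \<Rightarrow> real" where
  "load_payment lamd lamr D x = lamd * x + lamr * (D - x)"

text \<open>
  Real-time clearing leaves \<open>lamr\<close> undetermined if both supply and demand vanish; the price is
  then set to the day-ahead one.
\<close>

definition rt_clearing ::
  "'g set \<Rightarrow> ('g \<Rightarrow> real) \<Rightarrow> real \<Rightarrow> real \<Rightarrow> real \<Rightarrow> bool" where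
  "rt_clearing G theta Dr lamd lamr \<longleftrightarrow>
     (\<Sum>j\<in>G. rt_dispatch theta lamr j) = Dr \<and>
     ((\<Sum>j\<in>G. rt_dispatch theta lamr j) = 0 \<and> Dr = 0 \<longrightarrow> lamr = lamd)"

definition competitive_equilibrium ::
  "'g set \<Rightarrow> 'l set \<Rightarrow> ('g \<Rightarrow> real) \<Rightarrow> ('g \<Rightarrow> real) \<Rightarrow> ('l \<Rightarrow> real) \<Rightarrow>
   ('g \<Rightarrow> real) \<Rightarrow> ('l \<Rightarrow> real) \<Rightarrow> ('l \<Rightarrow> real) \<Rightarrow> real \<Rightarrow> real \<Rightarrow> bool" where
  "competitive_equilibrium G L c eps dem theta dd dr lamd lamr \<longleftrightarrow>
     (\<forall>j\<in>G. is_arg_max (gen_profit G c eps (\<Sum>l\<in>L. dd l) lamr j) (\<lambda>_. True) (theta j)) \<and>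
     (\<forall>l\<in>L. dd l + dr l = dem l \<and>
        is_arg_min (load_payment lamd lamr (dem l)) (\<lambda>_. True) (dd l)) \<and>
     (\<Sum>j\<in>G. da_dispatch c eps lamd j) = (\<Sum>l\<in>L. dd l) \<and>
     lamd = da_price G c eps (\<Sum>l\<in>L. dd l) \<and>
     rt_clearing G theta (\<Sum>l\<in>L. dr l) lamd lamr"

end

theory Submission
  imports Defs
begin

text \<open>
  A load's payment is affine in its day-ahead allocation with slope \<open>\<lambda>\<^sup>d - \<lambda>\<^sup>r\<close>, so an optimum
  exists only if \<open>\<lambda>\<^sup>d = \<lambda>\<^sup>r = p\<close>. The common price is nonzero: \<open>p = 0\<close> would make both \<open>d\<^sup>d\<close> and
  \<open>d\<^sup>r\<close> vanish, contradicting \<open>d > 0\<close>. A generator's profit is then a strictly concave quadratic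
  in its bid, maximal exactly when marginal cost equals price, that is when its total output is
  \<open>p / c\<^sub>j\<close>. Summing over the generators gives \<open>p\<close>.
\<close>

lemma is_arg_min_load_payment_iff:
  "is_arg_min (load_payment lamd lamr D) (\<lambda>_. True) x \<longleftrightarrow> lamd = lamr"
proof
  assume opt: "is_arg_min (load_payment lamd lamr D) (\<lambda>_. True) x"
  \<comment> \<open>The test point moves against the slope by the slope itself, so the payment drops
    by exactly its square.\<close>
  have diff: "load_payment lamd lamr D (x - (lamd - lamr))
      = load_payment lamd lamr D x - (lamd - lamr)\<^sup>2"
    by (simp add: load_payment_def algebra_simps power2_eq_square)
  have "\<not> load_payment lamd lamr D (x - (lamd - lamr)) < load_payment lamd lamr D x"
    using opt by (auto simp: is_arg_min_def)
  then have "\<not> (lamd - lamr)\<^sup>2 > 0"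
    unfolding diff by simp
  then show "lamd = lamr"
    by simp
next
  assume "lamd = lamr"
  then show "is_arg_min (load_payment lamd lamr D) (\<lambda>_. True) x"
    by (simp add: is_arg_min_def load_payment_def algebra_simps)
qed

text \<open>Since \<open>p\<close> is nonzero, the bid \<open>- q / p\<close> makes the square
  vanish, so the maximal value is \<open>r\<close> and any other maximizer must annihilate the
  square too.\<close>

lemma is_arg_max_concave_quadratic_iff:
  fixes a p q r t :: real
  assumes "a > 0" and "p \<noteq> 0"
  shows "is_arg_max (\<lambda>x. r - a * (q + x * p)\<^sup>2) (\<lambda>_. True) t \<longleftrightarrow> q + t * p = 0"
proof
  assume "is_arg_max (\<lambda>x. r - a * (q + x * p)\<^sup>2) (\<lambda>_. True) t"
  then have "\<not> r - a * (q + t * p)\<^sup>2 < r - a * (q + (- q / p) * p)\<^sup>2"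
    unfolding is_arg_max_def by blast
  then have "\<not> a * (q + t * p)\<^sup>2 > 0"
    using assms by simp
  then show "q + t * p = 0"
    using assms by (simp add: zero_less_mult_iff)
next
  assume "q + t * p = 0"
  then show "is_arg_max (\<lambda>x. r - a * (q + x * p)\<^sup>2) (\<lambda>_. True) t"
    using assms by (simp add: is_arg_max_def not_less)
qed

text \<open>Completing the square in the total output \<open>q + x * lamr\<close> puts the vertex at
  \<open>lamr / c j\<close>, where marginal cost meets the price; \<open>r\<close> collects the
  terms free of the bid.\<close>

lemma is_arg_max_gen_profit_iff:
  assumes "c j > 0" and "lamr \<noteq> 0"
  shows "is_arg_max (gen_profit G c eps Dd lamr j) (\<lambda>_. True) t
    \<longleftrightarrow> da_share G c eps j * Dd + t * lamr = lamr / c j"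
proof -
  define q where "q = da_share G c eps j * Dd"
  define r where "r = (c j + eps j) * q\<^sup>2 - q * lamr + lamr\<^sup>2 / (2 * c j)"
  have "gen_profit G c eps Dd lamr j = (\<lambda>x. r - c j / 2 * ((q - lamr / c j) + x * lamr)\<^sup>2)"
    using assms(1)
    by (simp add: fun_eq_iff gen_profit_def r_def flip: q_def)
      (simp add: field_simps power2_eq_square)
  then show ?thesis
    using is_arg_max_concave_quadratic_iff[of "c j / 2" lamr r "q - lamr / c j" t] assms
    by (auto simp: q_def)
qed

lemma sum_inverse_pos:
  fixes f :: "'a \<Rightarrow> real"
  assumes "finite A" and "A \<noteq> {}" and "\<And>x. x \<in> A \<Longrightarrow> f x > 0"
  shows "(\<Sum>x\<in>A. inverse (f x)) > 0"
  using assms by (intro sum_pos) auto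

theorem theorem5:
  fixes G :: "'g set" and L :: "'l set"
    and c eps :: "'g \<Rightarrow> real" and dem :: "'l \<Rightarrow> real" and d :: real
  assumes "finite G" and "G \<noteq> {}" and "finite L" and "L \<noteq> {}"
    and "\<forall>j\<in>G. c j > 0" and "\<forall>j\<in>G. eps j \<ge> 0"
    and "d = (\<Sum>l\<in>L. dem l)" and "d > 0"
  shows "(\<exists>theta dd dr lamd lamr.
            competitive_equilibrium G L c eps dem theta dd dr lamd lamr) \<and>
         (\<forall>theta dd dr lamd lamr.
            competitive_equilibrium G L c eps dem theta dd dr lamd lamr \<longleftrightarrow>
              (\<forall>j\<in>G. da_dispatch c eps lamd j
                       = inverse (c j + eps j) / (\<Sum>k\<in>G. inverse (c k)) * d) \<and>
              (\<forall>j\<in>G. rt_dispatch theta lamr j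
                       = eps j * inverse (c j) / (c j + eps j) * (d / (\<Sum>k\<in>G. inverse (c k)))) \<and>
              (\<forall>l\<in>L. dd l + dr l = dem l) \<and>
              (\<Sum>l\<in>L. dd l)
                = (\<Sum>j\<in>G. inverse (c j + eps j)) / (\<Sum>j\<in>G. inverse (c j)) * d \<and>
              (\<Sum>l\<in>L. dr l) = d - (\<Sum>l\<in>L. dd l) \<and>
              (\<forall>j\<in>G. theta j = eps j * inverse (c j) / (c j + eps j)) \<and>
              lamd = d / (\<Sum>j\<in>G. inverse (c j)) \<and>
              lamr = d / (\<Sum>j\<in>G. inverse (c j)))"
proof -
  define S where "S = (\<Sum>j\<in>G. inverse (c j + eps j))"
  define C where "C = (\<Sum>j\<in>G. inverse (c j))"
  define bid where "bid j = eps j * inverse (c j) / (c j + eps j)" for j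
  have ce: "c j > 0" "eps j \<ge> 0" "c j + eps j > 0" if "j \<in> G" for j
    using assms(5,6) that by (auto simp: add_pos_nonneg)
  have S: "S > 0" and C: "C > 0"
    unfolding S_def C_def using assms(1,2) ce by (auto intro!: sum_inverse_pos)
  \<comment> \<open>The bid is the gap between the slope of true marginal-cost supply and the slope
    imposed day-ahead, hence the total \<open>C - S\<close>.\<close>
  have bid_eq: "bid j = inverse (c j) - inverse (c j + eps j)" if "j \<in> G" for j
    using ce[OF that] by (simp add: bid_def field_simps)
  have sum_bid: "(\<Sum>j\<in>G. bid j) = C - S"
    by (simp add: bid_eq S_def C_def sum_subtractf)
  \<comment> \<open>At a day-ahead price \<open>p\<close> the day-ahead demand is
    \<open>p * S\<close>. If the real-time price is \<open>p\<close> as well, it cancels from the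
    optimality condition, leaving a best response independent of \<open>p\<close>.\<close>
  have bid_optimal: "is_arg_max (gen_profit G c eps (p * S) p j) (\<lambda>_. True) t \<longleftrightarrow> t = bid j"
    if "j \<in> G" and "p \<noteq> 0" for p t j
  proof -
    have share: "da_share G c eps j * (p * S) = inverse (c j + eps j) * p"
      using S by (simp add: da_share_def flip: S_def)
    have "is_arg_max (gen_profit G c eps (p * S) p j) (\<lambda>_. True) t
        \<longleftrightarrow> (inverse (c j + eps j) + t) * p = inverse (c j) * p"
      unfolding is_arg_max_gen_profit_iff[where c = c, OF ce(1)[OF that(1)] that(2)] share
      by (simp only: distrib_left divide_inverse mult.commute)
    then show ?thesis
      using that by (auto simp: bid_eq)
  qed
  have total_demand: "(\<Sum>l\<in>L. dd l) + (\<Sum>l\<in>L. dr l) = d" if "\<forall>l\<in>L. dd l + dr l = dem l"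
    for dd dr :: "'l \<Rightarrow> real"
    using that by (simp add: assms(7) flip: sum.distrib)
  \<comment> \<open>This is the characterization cut down to independent data: both dispatches and
    the real-time demand follow from the bids, prices and allocations listed here.\<close>
  have equilibrium_iff: "competitive_equilibrium G L c eps dem theta dd dr lamd lamr \<longleftrightarrow>
      (\<forall>j\<in>G. theta j = bid j) \<and> (\<forall>l\<in>L. dd l + dr l = dem l) \<and>
      (\<Sum>l\<in>L. dd l) = S / C * d \<and> lamd = d / C \<and> lamr = d / C"
    (is "_ \<longleftrightarrow> ?R") for theta dd dr lamd lamr
  proof
    assume eq: "competitive_equilibrium G L c eps dem theta dd dr lamd lamr"
    \<comment> \<open>A single load suffices to equate the prices, and \<open>L\<close> is
      nonempty.\<close>
    have split: "\<forall>l\<in>L. dd l + dr l = dem l" and lam: "lamd = lamr"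
      using eq assms(4) by (auto simp: competitive_equilibrium_def is_arg_min_load_payment_iff)
    have d: "(\<Sum>l\<in>L. dd l) + (\<Sum>l\<in>L. dr l) = d"
      using split by (rule total_demand)
    have dd: "(\<Sum>l\<in>L. dd l) = lamr * S"
      using eq lam S by (simp add: competitive_equilibrium_def da_price_def flip: S_def)
    have dr: "(\<Sum>l\<in>L. dr l) = (\<Sum>j\<in>G. theta j) * lamr"
      using eq
      by (simp add: competitive_equilibrium_def rt_clearing_def rt_dispatch_def sum_distrib_right)
    have nz: "lamr \<noteq> 0"
      using d dd dr assms(8) by auto
    have theta: "\<forall>j\<in>G. theta j = bid j"
      using eq nz by (simp add: competitive_equilibrium_def dd bid_optimal)
    then have "(\<Sum>l\<in>L. dr l) = (C - S) * lamr"
      using dr sum_bid by simp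
    then have "lamr * C = d"
      using d dd by (simp add: algebra_simps)
    then have "lamr = d / C"
      using C by (simp add: field_simps)
    then show ?R
      using split lam dd theta by simp
  next
    assume R: ?R
    then have theta: "\<forall>j\<in>G. theta j = bid j" and split: "\<forall>l\<in>L. dd l + dr l = dem l"
      and lam: "lamd = lamr"
      by auto
    have p: "lamr \<noteq> 0" and dd: "(\<Sum>l\<in>L. dd l) = lamr * S"
      using R C assms(8) by auto
    have dr: "(\<Sum>l\<in>L. dr l) = lamr * (C - S)"
    proof -
      have "(\<Sum>l\<in>L. dd l) + (\<Sum>l\<in>L. dr l) = d"
        using split by (rule total_demand)
      moreover have "d = lamr * C"
        using R C by simp
      ultimately show ?thesis
        using dd by (simp add: algebra_simps)
    qed
    have "(\<Sum>j\<in>G. da_dispatch c eps lamr j) = lamr * S"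
      by (simp add: da_dispatch_def S_def sum_distrib_left mult.commute)
    moreover have "da_price G c eps (lamr * S) = lamr"
      using S by (simp add: da_price_def flip: S_def)
    moreover have "(\<Sum>j\<in>G. rt_dispatch theta lamr j) = lamr * (C - S)"
    proof -
      have "(\<Sum>j\<in>G. rt_dispatch theta lamr j) = (\<Sum>j\<in>G. lamr * bid j)"
        using theta by (intro sum.cong) (auto simp: rt_dispatch_def)
      then show ?thesis
        by (simp only: sum_bid flip: sum_distrib_left)
    qed
    \<comment> \<open>If every \<open>eps j\<close> is zero, then \<open>C = S\<close> and real-time
      trade vanishes; the degenerate clause of \<open>rt_clearing\<close> holds because the prices
      agree.\<close>
    ultimately show "competitive_equilibrium G L c eps dem theta dd dr lamd lamr"
      using theta split lam p
      by (simp add: competitive_equilibrium_def rt_clearing_def dd dr bid_optimal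
          is_arg_min_load_payment_iff)
  qed
  have rt_demand: "(\<Sum>l\<in>L. dr l) = d - (\<Sum>l\<in>L. dd l)" if "\<forall>l\<in>L. dd l + dr l = dem l"
    for dd dr :: "'l \<Rightarrow> real"
    using total_demand[OF that] by simp
  \<comment> \<open>As a witness for existence, every load buys the same fraction
    \<open>S / C\<close> of its demand day-ahead, which yields the required total.\<close>
  have "(\<Sum>l\<in>L. S / C * dem l) = S / C * d"
    by (simp only: assms(7) sum_distrib_left)
  then have "competitive_equilibrium G L c eps dem bid
      (\<lambda>l. S / C * dem l) (\<lambda>l. dem l - S / C * dem l) (d / C) (d / C)"
    by (simp add: equilibrium_iff)
  then show ?thesis
    unfolding S_def[symmetric] C_def[symmetric] bid_def[symmetric]
    by (intro conjI allI) (blast, auto simp: equilibrium_iff rt_demand da_dispatch_def rt_dispatch_def)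
qed

end
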